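(* For any $k\ge 1$ and given indices $\mathbf{i}=(i_1,\dots,i_k)$ and $\mathbf{j}=(j_1,\dots,j_k)$, where $i_1,\dots,i_k,j_1,\dots,j_k\in\{1,2,\dots,N\}$, there exists some Weingarten function $\mathrm{Wg}_k$ so that $$\int_{g\in S_N} g_{i_1j_1}\cdots g_{i_kj_k}\,dg=\sum_{\sigma,\tau\in\mathcal{P}(k)}\mathrm{Wg}_k(\sigma,\tau,N)\,\zeta(\sigma,\Pi_{\mathbf{i}})\,\zeta(\tau,\Pi_{\mathbf{j}}).$$ Moreover, we have the following explicit formula for $\mathrm{Wg}_k(\sigma,\tau,N)$: $$\mathrm{Wg}_k(\sigma,\tau,N)=\sum_{\substack{\pi\in\mathcal{P}(k)\\ \pi\le\sigma\wedge\tau}}\mu(\pi,\sigma)\,\mu(\pi,\tau)\,\frac{1}{(N)_{\#\pi}}.$$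
   Context: An element $g$ of the symmetric group $S_N$ is identified with its $N\times N$ permutation matrix: $g_{rs}=1$ if $g(r)=s$ and $g_{rs}=0$ otherwise. The integral is over the normalized Haar measure on $S_N$: $\int_{g\in S_N} f(g)\,dg=\frac{1}{N!}\sum_{g\in S_N}f(g)$. $\mathcal{P}(k)$ is the lattice of set partitions of $[k]=\{1,\dots,k\}$, ordered by refinement: $\pi_1\le\pi_2$ iff every block of $\pi_1$ is contained in a block of $\pi_2$; $\wedge$ is the greatest lower bound (meet). $\#\pi$ is the number of blocks of $\pi$. $\zeta(\pi_1,\pi_2)=1$ if $\pi_1\le\pi_2$ and $0$ otherwise. For $\pi_1\le\pi_2$, if the blocks $B_1,\dots,B_r$ of $\pi_2$ are split into $\lambda_1,\dots,\lambda_r$ blocks of $\pi_1$ respectively, then $\mu(\pi_1,\pi_2)=\prod_{i=1}^{r}(-1)^{\lambda_i-1}(\lambda_i-1)!$ (the Möbius function of $\mathcal{P}(k)$). For a multi-index $\mathbf{i}=(i_1,\dots,i_k)$, $\Pi_{\mathbf{i}}\in\mathcal{P}(k)$ is the partition in which $l,m$ lie in the same block iff $i_l=i_m$. $(x)_n=x(x-1)\cdots(x-n+1)$ is the falling factorial. *)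

theory Defs
  imports
    Complex_Main
    "HOL-Library.Disjoint_Sets"
    "HOL-Library.FuncSet"
    "HOL-Combinatorics.Permutations"
begin

definition perm_matrix :: "(nat \<Rightarrow> nat) \<Rightarrow> nat \<Rightarrow> nat \<Rightarrow> real" where
  "perm_matrix g r s = (if g r = s then 1 else 0)"

text \<open>Integration against the normalized Haar measure on the symmetric group of \<open>{1..N}\<close>.\<close>

definition sym_integral :: "nat \<Rightarrow> ((nat \<Rightarrow> nat) \<Rightarrow> real) \<Rightarrow> real" where
  "sym_integral N f = 1 / fact N * (\<Sum>g | g permutes {1..N}. f g)"

definition set_partitions :: "nat \<Rightarrow> nat set set set" where
  "set_partitions k = {\<pi>. partition_on {1..k} \<pi>}"

definition index_partition :: "nat \<Rightarrow> (nat \<Rightarrow> nat) \<Rightarrow> nat set set" where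
  "index_partition k i = {1..k} // {(l, m). l \<in> {1..k} \<and> m \<in> {1..k} \<and> i l = i m}"

definition zeta :: "nat \<Rightarrow> nat set set \<Rightarrow> nat set set \<Rightarrow> real" where
  "zeta k \<pi>1 \<pi>2 = (if refines {1..k} \<pi>1 \<pi>2 then 1 else 0)"

text \<open>
  The number of blocks into which \<open>\<pi>1\<close> splits a block \<open>B\<close> of \<open>\<pi>2\<close> is
  \<open>card {A \<in> \<pi>1. A \<subseteq> B}\<close>; it is positive when \<open>\<pi>1\<close> refines \<open>\<pi>2\<close>, so the truncated
  subtraction is harmless. Off the refinement order we use the usual convention that the
  value is 0.
\<close>

definition moebius :: "nat \<Rightarrow> nat set set \<Rightarrow> nat set set \<Rightarrow> real" where
  "moebius k \<pi>1 \<pi>2 =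
     (if refines {1..k} \<pi>1 \<pi>2
      then \<Prod>B\<in>\<pi>2. (- 1) ^ (card {A \<in> \<pi>1. A \<subseteq> B} - 1) * fact (card {A \<in> \<pi>1. A \<subseteq> B} - 1)
      else 0)"

text \<open>
  In the Weingarten formula, when \<open>N < card \<pi>\<close> the falling factorial vanishes, and the informal quotient
  \<open>1 / (N)\<^bsub>card \<pi>\<^esub>\<close> is undefined; here such terms contribute 0, as \<open>1 / 0 = 0\<close> in HOL.
\<close>

definition falling_factorial :: "real \<Rightarrow> nat \<Rightarrow> real" where
  "falling_factorial x n = (\<Prod>m<n. x - real m)"

text \<open>
  The meet of \<open>\<sigma>\<close> and \<open>\<tau>\<close> is \<open>common_refinement {\<sigma>, \<tau>}\<close>; the following shows that this is
  their greatest lower bound.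
\<close>

lemma common_refinement_is_meet:
  assumes "\<sigma> \<in> set_partitions k" and "\<tau> \<in> set_partitions k"
  shows "common_refinement {\<sigma>, \<tau>} \<in> set_partitions k"
    and "refines {1..k} \<pi> (common_refinement {\<sigma>, \<tau>}) \<longleftrightarrow>
           refines {1..k} \<pi> \<sigma> \<and> refines {1..k} \<pi> \<tau>"
proof -
  have part: "partition_on {1..k} P" if "P \<in> {\<sigma>, \<tau>}" for P
    using assms that by (auto simp: set_partitions_def)
  show "common_refinement {\<sigma>, \<tau>} \<in> set_partitions k"
    unfolding set_partitions_def mem_Collect_eq
    by (rule partition_on_common_refinement[OF part]) simp_all
  show "refines {1..k} \<pi> (common_refinement {\<sigma>, \<tau>}) \<longleftrightarrow>
          refines {1..k} \<pi> \<sigma> \<and> refines {1..k} \<pi> \<tau>" (is "?L \<longleftrightarrow> ?R")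
  proof
    assume ?L
    then show ?R
      using refines_common_refinement[of "{\<sigma>, \<tau>}" "{1..k}" \<sigma>, OF part]
        refines_common_refinement[of "{\<sigma>, \<tau>}" "{1..k}" \<tau>, OF part]
      by (meson insertI1 insertI2 refines_trans)
  next
    assume ?R
    moreover from this have "partition_on {1..k} \<pi>"
      by (simp add: refines_def)
    ultimately show ?L
      by (intro common_refinement_coarsest[OF part]) auto
  qed
qed

end

theory Submission
  imports Defs
begin

text \<open>
  Interchanging the sums turns the right-hand side into
  \<open>\<Sum>\<pi>. 1 / (N)\<^bsub>#\<pi>\<^esub> * (\<Sum>\<sigma>. \<mu>(\<pi>, \<sigma>) \<zeta>(\<sigma>, \<Pi>\<^sub>i)) * (\<Sum>\<tau>. \<mu>(\<pi>, \<tau>) \<zeta>(\<tau>, \<Pi>\<^sub>j))\<close>.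
  By Moebius inversion (\<open>moebius_inverts_zeta\<close>) the inner sums are Kronecker deltas, so only the
  term \<open>\<pi> = \<Pi>\<^sub>i = \<Pi>\<^sub>j\<close> survives. The integral has the same value (\<open>sym_integral_monomial\<close>): it
  is the proportion of permutations \<open>g\<close> with \<open>g(i\<^sub>l) = j\<^sub>l\<close> for all \<open>l\<close>. The injectivity of \<open>g\<close>
  rules these out unless \<open>\<Pi>\<^sub>i = \<Pi>\<^sub>j\<close>; in that case \<open>g\<close> is prescribed injectively on
  \<open>b = #\<Pi>\<^sub>i\<close> points, which leaves \<open>(N - b)!\<close> of the \<open>N!\<close> permutations.

  Since \<open>\<mu>\<close> is given by its explicit product, Moebius inversion has to be proved for that product.
  Partitions \<open>\<sigma> \<ge> \<pi>\<close> are the partitions of the set of blocks of \<open>\<pi>\<close>, and \<open>\<sigma> \<le> \<rho>\<close> says that each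
  block of \<open>\<sigma>\<close> merges only blocks of \<open>\<pi>\<close> that lie in the same block of \<open>\<rho>\<close>, their ``colour''.
  What remains is a weighted count of monochromatic partitions of a coloured set
  (\<open>sum_weights_monochromatic_partitions\<close>), done by adding the elements of the set one at a time.
\<close>

section \<open>Signed weights of set partitions\<close>

text \<open>
  For \<open>n \<ge> 1\<close> this is the Moebius function of the whole partition lattice of an \<open>n\<close>-element set,
  evaluated between its least and greatest elements.
\<close>

definition block_weight :: "nat \<Rightarrow> real" where
  "block_weight n = (- 1) ^ (n - 1) * fact (n - 1)"

lemma block_weight_Suc: "n > 0 \<Longrightarrow> block_weight (Suc n) = - real n * block_weight n"
  unfolding block_weight_def by (cases n) (auto simp: algebra_simps)

text \<open>
  The new element \<open>y\<close> either joins an existing block \<open>C\<close> or forms a block of its own. Coding the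
  second choice by \<open>C = {}\<close> lets one formula cover both, because \<open>{}\<close> is never a block.
\<close>

lemma partitions_of_insert_bij:
  assumes "y \<notin> X"
  shows "bij_betw (\<lambda>(P, C). insert (insert y C) (P - {C}))
           (SIGMA P:{P. partition_on X P}. insert {} P) {Q. partition_on (insert y X) Q}"
    (is "bij_betw ?extend ?S ?T")
proof -
  define block where "block = (\<lambda>Q::'a set set. THE B. B \<in> Q \<and> y \<in> B)"
  define remove where
    "remove = (\<lambda>Q. ((Q - {block Q}) \<union> ({block Q - {y}} - {{}}), block Q - {y}))"
  have block_eq: "block Q = B" if "partition_on (insert y X) Q" "B \<in> Q" "y \<in> B" for Q B
    unfolding block_def
  proof (rule the_equality)
    fix B' assume "B' \<in> Q \<and> y \<in> B'"
    then show "B' = B"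
      using that partition_onD2[OF that(1)] by (auto simp: disjoint_def)
  qed (use that in auto)
  have extend: "?extend (P, C) \<in> ?T \<and> remove (?extend (P, C)) = (P, C)"
    if "partition_on X P" "C \<in> insert {} P" for P C
  proof -
    have ne: "{} \<notin> P" and un: "\<Union>P = X" and dis: "disjoint P"
      using that(1) by (auto simp: partition_on_def)
    have y: "y \<notin> B" if "B \<in> P" for B using that un assms by auto
    have CB: "C \<inter> B = {}" if "B \<in> P" "B \<noteq> C" for B
      using that \<open>C \<in> insert {} P\<close> dis by (auto simp: disjoint_def)
    have part: "partition_on (insert y X) (insert (insert y C) (P - {C}))"
    proof (subst partition_on_insert)
      show "disjnt (insert y C) (\<Union> (P - {C}))"
        using y CB by (auto simp: disjnt_def)
      have "\<Union> (P - {C}) = insert y X - insert y C"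
        using CB y un assms by blast
      moreover have "disjoint (P - {C})"
        using dis by (auto simp: disjoint_def)
      moreover have "C \<subseteq> X" using that un by auto
      ultimately show "partition_on (insert y X - insert y C) (P - {C}) \<and>
          insert y C \<subseteq> insert y X \<and> insert y C \<noteq> {}"
        using ne by (auto simp: partition_on_def)
    qed
    have bl: "block (insert (insert y C) (P - {C})) = insert y C"
      by (rule block_eq[OF part]) auto
    have yC: "y \<notin> C" using that y by auto
    have "insert y C \<notin> P" using y by auto
    then have "remove (insert (insert y C) (P - {C})) = (P, C)"
      unfolding remove_def bl using yC that ne by auto
    then show ?thesis using part by simp
  qed
  have remove: "remove Q \<in> ?S \<and> ?extend (remove Q) = Q" if Q: "partition_on (insert y X) Q" for Q
  proof -
    have ne: "{} \<notin> Q" and un: "\<Union>Q = insert y X" and dis: "disjoint Q"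
      using Q by (auto simp: partition_on_def)
    obtain B where B: "B \<in> Q" "y \<in> B" using un by auto
    have bl: "block Q = B" by (rule block_eq[OF Q B])
    have BD: "B \<inter> D = {}" if "D \<in> Q" "D \<noteq> B" for D
      using that B dis by (auto simp: disjoint_def)
    have notin: "B - {y} \<notin> Q"
    proof
      assume a: "B - {y} \<in> Q"
      then have "B - {y} \<noteq> {}" using ne by metis
      then show False using BD[OF a] B by auto
    qed
    let ?P = "(Q - {B}) \<union> ({B - {y}} - {{}})"
    have "\<Union>?P = X"
    proof -
      have "\<Union>?P = \<Union>(Q - {B}) \<union> (B - {y})" by auto
      also have "\<dots> = \<Union>Q - {y}" using BD B by blast
      finally show ?thesis using un assms by auto
    qed
    moreover have "disjoint ?P"
      using dis BD by (auto simp: disjoint_def)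
    ultimately have part: "partition_on X ?P"
      using ne by (auto simp: partition_on_def)
    have "?P - {B - {y}} = Q - {B}" using notin by blast
    moreover have "insert y (B - {y}) = B" using B by blast
    ultimately have "insert (insert y (B - {y})) (?P - {B - {y}}) = Q"
      using B(1) by (simp only: insert_Diff)
    then show ?thesis using part by (auto simp: remove_def bl)
  qed
  show ?thesis
    by (rule bij_betwI[where g = remove]) (use extend remove in auto)
qed

text \<open>
  If a new element \<open>y\<close> forms its own block, the weight of a monochromatic partition does not
  change; if it joins a block \<open>C\<close> of its colour, the weight is multiplied by \<open>- card C\<close>. So all the
  extensions of a partition of \<open>X\<close> together contribute \<open>1 - m\<close> times its weight, where \<open>m\<close> is the
  number of elements of \<open>X\<close> with the colour of \<open>y\<close>. While the colouring is injective, \<open>m\<close> is \<open>0\<close>,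
  and the first repeated colour has \<open>m = 1\<close>, which makes the sum vanish from then on.
\<close>

theorem sum_weights_monochromatic_partitions:
  fixes f :: "'a \<Rightarrow> 'b"
  assumes "finite X"
  shows "(\<Sum>P | partition_on X P \<and> (\<forall>C\<in>P. \<forall>x\<in>C. \<forall>y\<in>C. f x = f y). \<Prod>C\<in>P. block_weight (card C))
           = (if inj_on f X then 1 else 0)"
proof -
  define mono where "mono = (\<lambda>P. \<forall>C\<in>P. \<forall>x\<in>C. \<forall>y\<in>C. f x = f y)"
  define g where "g = (\<lambda>P. if mono P then \<Prod>C\<in>P. block_weight (card C) else 0)"
  have "(\<Sum>P | partition_on X P. g P) = (if inj_on f X then 1 else 0)"
    using assms
  proof (induction X)
    case empty
    show ?case by (simp add: partition_on_empty g_def mono_def)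
  next
    case (insert y X)
    let ?m = "card {x \<in> X. f x = f y}"
    have step: "(\<Sum>C\<in>insert {} P. g (insert (insert y C) (P - {C}))) = (1 - real ?m) * g P"
      if P: "partition_on X P" for P
    proof -
      have ne: "{} \<notin> P" and un: "\<Union>P = X" and dis: "disjoint P"
        using P by (auto simp: partition_on_def)
      have fin: "finite P" using finite_elements[OF insert(1) P] .
      have finC: "finite C" if "C \<in> P" for C
        using that un insert(1) by (meson Union_upper finite_subset)
      have y: "y \<notin> B" if "B \<in> P" for B using that un insert(2) by auto
      have notin: "insert y C \<notin> P" for C using y by auto
      have "mono (insert {y} P) = mono P" by (simp add: mono_def)
      then have g0: "g (insert {y} P) = g P"
        using fin notin[of "{}"] by (simp add: g_def block_weight_def)
      have gC: "g (insert (insert y C) (P - {C})) =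
          - (if \<forall>x\<in>C. f x = f y then real (card C) else 0) * g P" if C: "C \<in> P" for C
      proof (cases "mono P \<and> (\<forall>x\<in>C. f x = f y)")
        case True
        then have "mono (insert (insert y C) (P - {C}))"
          by (auto simp: mono_def)
        then have "g (insert (insert y C) (P - {C})) =
            block_weight (Suc (card C)) * (\<Prod>C\<in>P-{C}. block_weight (card C))"
          using fin notin finC[OF C] y[OF C] by (simp add: g_def)
        also have "\<dots> = - real (card C) * (block_weight (card C) * (\<Prod>C\<in>P-{C}. block_weight (card C)))"
        proof -
          have "card C > 0" using finC[OF C] C ne by (metis card_gt_0_iff)
          then show ?thesis by (simp add: block_weight_Suc)
        qed
        also have "\<dots> = - real (card C) * (\<Prod>C\<in>P. block_weight (card C))"
          using prod.remove[OF fin C, of "\<lambda>C. block_weight (card C)"] by simp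
        finally show ?thesis using True by (simp add: g_def)
      next
        case False
        have "\<not> mono (insert (insert y C) (P - {C}))"
        proof
          assume m: "mono (insert (insert y C) (P - {C}))"
          have C_y: "f x = f z" if "x \<in> insert y C" "z \<in> insert y C" for x z
            by (rule m[unfolded mono_def, rule_format, of "insert y C"]) (use that in auto)
          have "f x = f z" if "D \<in> P" "x \<in> D" "z \<in> D" for D x z
          proof (cases "D = C")
            case False
            show ?thesis
              by (rule m[unfolded mono_def, rule_format, of D]) (use that False in auto)
          qed (use C_y that in auto)
          then have "mono P" unfolding mono_def by blast
          with C_y False show False by blast
        qed
        then show ?thesis using False by (auto simp: g_def)
      qed
      \<comment> \<open>In a monochromatic partition the elements coloured like \<open>y\<close> fill whole blocks.\<close>
      have "real ?m = (\<Sum>x\<in>X. if f x = f y then 1 else 0)"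
        using insert(1) by (simp add: sum.If_cases Int_def)
      also have "\<dots> = (\<Sum>C\<in>P. \<Sum>x\<in>C. if f x = f y then 1 else 0)"
        by (rule sum.partition[OF insert(1) P])
      finally have "real ?m * g P = (\<Sum>C\<in>P. (\<Sum>x\<in>C. if f x = f y then 1 else 0) * g P)"
        by (simp add: sum_distrib_right)
      also have "\<dots> = (\<Sum>C\<in>P. (if \<forall>x\<in>C. f x = f y then real (card C) else 0) * g P)"
      proof (cases "mono P")
        case True
        have "(\<Sum>x\<in>C. if f x = f y then 1 else 0) = (if \<forall>x\<in>C. f x = f y then real (card C) else 0)"
          if C: "C \<in> P" for C
        proof (cases "\<forall>x\<in>C. f x = f y")
          case False
          then have "\<forall>x\<in>C. f x \<noteq> f y"
            using True C unfolding mono_def by metis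
          with False show ?thesis by simp
        qed simp
        then show ?thesis by simp
      qed (simp add: g_def)
      also have "\<dots> = - (\<Sum>C\<in>P. g (insert (insert y C) (P - {C})))"
        unfolding sum_negf[symmetric] by (rule sum.cong) (auto simp: gC)
      finally show ?thesis
        using fin ne g0 by (simp add: algebra_simps)
    qed
    have finP: "finite P" if "partition_on X P" for P
      using finite_elements[OF insert(1) that] .
    have "(\<Sum>Q | partition_on (insert y X) Q. g Q) =
        (\<Sum>(P, C)\<in>(SIGMA P:{P. partition_on X P}. insert {} P). g (insert (insert y C) (P - {C})))"
      by (subst sum.reindex_bij_betw[OF partitions_of_insert_bij[OF insert(2)], symmetric])
        (simp add: case_prod_unfold)
    also have "\<dots> = (\<Sum>P | partition_on X P. \<Sum>C\<in>insert {} P. g (insert (insert y C) (P - {C})))"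
      using finitely_many_partition_on[OF insert(1)] finP
      by (subst sum.Sigma) auto
    also have "\<dots> = (\<Sum>P | partition_on X P. (1 - real ?m) * g P)"
      by (rule sum.cong) (use step in auto)
    also have "\<dots> = (1 - real ?m) * (if inj_on f X then 1 else 0)"
      by (simp add: sum_distrib_left[symmetric] insert.IH)
    also have "\<dots> = (if inj_on f (insert y X) then 1 else 0)"
    proof (cases "inj_on f X")
      case True
      show ?thesis
      proof (cases "f y \<in> f ` X")
        case False
        then have "{x \<in> X. f x = f y} = {}" by (metis (mono_tags, lifting) Collect_empty_eq image_eqI)
        then have "?m = 0" by (simp only: card.empty)
        then show ?thesis using True False insert(2) by (simp add: inj_on_insert)
      next
        case img: True
        then obtain x where "x \<in> X" "f x = f y" by (metis imageE)
        then have "{x \<in> X. f x = f y} = {x}" using True by (auto simp: inj_on_def)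
        then have "?m = 1" by simp
        then show ?thesis using True img insert(2) by (simp add: inj_on_insert)
      qed
    qed (auto simp: inj_on_insert)
    finally show ?case .
  qed
  then show ?thesis
    using finitely_many_partition_on[OF assms]
    by (simp add: g_def mono_def sum.If_cases Int_def)
qed

section \<open>Moebius inversion on the partition lattice\<close>

lemma blocks_below_Union:
  assumes "partition_on A \<pi>" "C \<subseteq> \<pi>"
  shows "{P \<in> \<pi>. P \<subseteq> \<Union>C} = C"
proof (intro equalityI subsetI)
  fix P assume "P \<in> {P \<in> \<pi>. P \<subseteq> \<Union>C}"
  then have P: "P \<in> \<pi>" "P \<subseteq> \<Union>C" by auto
  then obtain x where "x \<in> P" using partition_onD3[OF assms(1)] by (metis ex_in_conv)
  then obtain Q where "Q \<in> C" "x \<in> Q" using P by auto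
  then have "P = Q"
    using P assms(2) \<open>x \<in> P\<close> disjointD[OF partition_onD2[OF assms(1)], of P Q] by blast
  then show "P \<in> C" using \<open>Q \<in> C\<close> by simp
qed (use assms in auto)

text \<open>
  The interval above \<open>\<pi>\<close> in the partition lattice is itself a partition lattice, that of the set of
  blocks of \<open>\<pi>\<close>.
\<close>

lemma coarsenings_bij:
  assumes \<pi>: "partition_on A \<pi>"
  shows "bij_betw ((`) Union) {\<Sigma>. partition_on \<pi> \<Sigma>} {\<sigma>. refines A \<pi> \<sigma>}"
proof (rule bij_betwI[where g = "\<lambda>\<sigma>. (\<lambda>B. {P \<in> \<pi>. P \<subseteq> B}) ` \<sigma>"])
  have below: "{P \<in> \<pi>. P \<subseteq> \<Union>C} = C" if "partition_on \<pi> \<Sigma>" "C \<in> \<Sigma>" for \<Sigma> C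
    using blocks_below_Union[OF \<pi>, of C] that by (auto simp: partition_on_def)
  have above: "\<Union>{P \<in> \<pi>. P \<subseteq> B} = B" if "refines A \<pi> \<sigma>" "B \<in> \<sigma>" for \<sigma> B
    using partition_onD1[OF refines_obtains_subset[OF that]] by simp
  show "(`) Union \<in> {\<Sigma>. partition_on \<pi> \<Sigma>} \<rightarrow> {\<sigma>. refines A \<pi> \<sigma>}"
  proof safe
    fix \<Sigma> assume S: "partition_on \<pi> \<Sigma>"
    have "partition_on A (Union ` \<Sigma>)"
    proof (rule partition_onI)
      show "\<Union> (Union ` \<Sigma>) = A"
        using partition_onD1[OF S] partition_onD1[OF \<pi>] by auto
      show "{} \<notin> Union ` \<Sigma>"
      proof
        assume "{} \<in> Union ` \<Sigma>"
        then obtain C where C: "C \<in> \<Sigma>" "\<Union>C = {}" by auto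
        then have "C = {} \<or> C = {{}}" by auto
        moreover have "C \<subseteq> \<pi>" using C S by (auto simp: partition_on_def)
        ultimately show False
          using C partition_onD3[OF S] partition_onD3[OF \<pi>] by blast
      qed
      fix p q assume "p \<in> Union ` \<Sigma>" "q \<in> Union ` \<Sigma>" "p \<noteq> q"
      then obtain C D where CD: "C \<in> \<Sigma>" "D \<in> \<Sigma>" "p = \<Union>C" "q = \<Union>D" "C \<noteq> D" by auto
      then have "C \<inter> D = {}" using partition_onD2[OF S] by (auto simp: disjoint_def)
      moreover have "C \<subseteq> \<pi>" "D \<subseteq> \<pi>" using CD S by (auto simp: partition_on_def)
      ultimately have "P \<inter> Q = {}" if "P \<in> C" "Q \<in> D" for P Q
        using that by (intro disjointD[OF partition_onD2[OF \<pi>]]) auto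
      then show "disjnt p q" unfolding CD disjnt_def by blast
    qed
    moreover have "\<exists>B\<in>Union ` \<Sigma>. P \<subseteq> B" if "P \<in> \<pi>" for P
      using that partition_onD1[OF S] by auto
    ultimately show "refines A \<pi> (Union ` \<Sigma>)" using \<pi> by (auto simp: refines_def)
  qed
  show "(\<lambda>\<sigma>. (\<lambda>B. {P \<in> \<pi>. P \<subseteq> B}) ` \<sigma>) \<in> {\<sigma>. refines A \<pi> \<sigma>} \<rightarrow> {\<Sigma>. partition_on \<pi> \<Sigma>}"
  proof safe
    fix \<sigma> assume r: "refines A \<pi> \<sigma>"
    then have s: "partition_on A \<sigma>" by (simp add: refines_def)
    show "partition_on \<pi> ((\<lambda>B. {P \<in> \<pi>. P \<subseteq> B}) ` \<sigma>)"
    proof (rule partition_onI)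
      show "\<Union> ((\<lambda>B. {P \<in> \<pi>. P \<subseteq> B}) ` \<sigma>) = \<pi>"
        using r by (auto simp: refines_def)
      show "{} \<notin> (\<lambda>B. {P \<in> \<pi>. P \<subseteq> B}) ` \<sigma>"
      proof
        assume "{} \<in> (\<lambda>B. {P \<in> \<pi>. P \<subseteq> B}) ` \<sigma>"
        then obtain B where B: "{} = {P \<in> \<pi>. P \<subseteq> B}" "B \<in> \<sigma>" by (rule imageE)
        then have "B = {}" using above[OF r B(2)] B(1) by simp
        then show False using B partition_onD3[OF s] by simp
      qed
      fix p q assume p: "p \<in> (\<lambda>B. {P \<in> \<pi>. P \<subseteq> B}) ` \<sigma>"
        and q: "q \<in> (\<lambda>B. {P \<in> \<pi>. P \<subseteq> B}) ` \<sigma>" and "p \<noteq> q"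
      obtain B where B: "p = {P \<in> \<pi>. P \<subseteq> B}" "B \<in> \<sigma>" using p by (rule imageE)
      obtain D where D: "q = {P \<in> \<pi>. P \<subseteq> D}" "D \<in> \<sigma>" using q by (rule imageE)
      have "B \<noteq> D" using B D \<open>p \<noteq> q\<close> by metis
      then have "B \<inter> D = {}" using disjointD[OF partition_onD2[OF s] B(2) D(2)] by simp
      then have "P = {}" if "P \<subseteq> B" "P \<subseteq> D" for P using that by blast
      then show "disjnt p q" unfolding B(1) D(1) disjnt_def using partition_onD3[OF \<pi>] by blast
    qed
  qed
  show "(\<lambda>B. {P \<in> \<pi>. P \<subseteq> B}) ` Union ` \<Sigma> = \<Sigma>" if "\<Sigma> \<in> {\<Sigma>. partition_on \<pi> \<Sigma>}" for \<Sigma>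
    using that below by (force simp: image_image)
  show "Union ` (\<lambda>B. {P \<in> \<pi>. P \<subseteq> B}) ` \<sigma> = \<sigma>" if "\<sigma> \<in> {\<sigma>. refines A \<pi> \<sigma>}" for \<sigma>
    using that above by (force simp: image_image)
qed

lemma moebius_coarsening:
  assumes \<pi>: "partition_on {1..k} \<pi>" and S: "partition_on \<pi> \<Sigma>"
  shows "moebius k \<pi> (Union ` \<Sigma>) = (\<Prod>C\<in>\<Sigma>. block_weight (card C))"
proof -
  have below: "{P \<in> \<pi>. P \<subseteq> \<Union>C} = C" if "C \<in> \<Sigma>" for C
    using blocks_below_Union[OF \<pi>, of C] S that by (auto simp: partition_on_def)
  then have "inj_on Union \<Sigma>"
    by (rule inj_on_inverseI[where g = "\<lambda>B. {P \<in> \<pi>. P \<subseteq> B}"])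
  moreover have "refines {1..k} \<pi> (Union ` \<Sigma>)"
    using bij_betwE[OF coarsenings_bij[OF \<pi>]] S by blast
  ultimately show ?thesis
    by (simp add: moebius_def prod.reindex block_weight_def below)
qed

text \<open>
  Colour each block of \<open>\<pi>\<close> by the block of \<open>\<rho>\<close> containing it. The sum over the interval from
  \<open>\<pi>\<close> to \<open>\<rho>\<close> becomes the weighted count of monochromatic partitions of \<open>\<pi>\<close>, and the colouring is
  injective exactly when no block of \<open>\<rho>\<close> is split by \<open>\<pi>\<close>.
\<close>

theorem moebius_inverts_zeta:
  assumes \<pi>: "\<pi> \<in> set_partitions k" and \<rho>: "\<rho> \<in> set_partitions k"
  shows "(\<Sum>\<sigma>\<in>set_partitions k. moebius k \<pi> \<sigma> * zeta k \<sigma> \<rho>) = (if \<pi> = \<rho> then 1 else 0)"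
proof (cases "refines {1..k} \<pi> \<rho>")
  case False
  then have "moebius k \<pi> \<sigma> * zeta k \<sigma> \<rho> = 0" for \<sigma>
    using refines_trans[of "{1..k}" \<pi> \<sigma> \<rho>] by (auto simp: moebius_def zeta_def)
  moreover have "\<pi> \<noteq> \<rho>"
    using False \<pi> refines_refl by (auto simp: set_partitions_def)
  ultimately show ?thesis by (simp only: sum.neutral_const if_False)
next
  case True
  \<comment> \<open>A singleton for each block of \<open>\<pi>\<close>; the set spares a choice operator.\<close>
  define colour where "colour = (\<lambda>P. {B \<in> \<rho>. P \<subseteq> B})"
  have p: "partition_on {1..k} \<pi>" and r: "partition_on {1..k} \<rho>"
    using \<pi> \<rho> by (auto simp: set_partitions_def)
  have colour_eq: "colour P = {B}" if "P \<in> \<pi>" "B \<in> \<rho>" "P \<subseteq> B" for P B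
  proof -
    have "P \<noteq> {}" using that partition_onD3[OF p] by auto
    then have "B' = B" if "B' \<in> \<rho>" "P \<subseteq> B'" for B'
      using disjointD[OF partition_onD2[OF r] that(1) \<open>B \<in> \<rho>\<close>] that(2) \<open>P \<subseteq> B\<close> by blast
    then show ?thesis using \<open>B \<in> \<rho>\<close> \<open>P \<subseteq> B\<close> unfolding colour_def by blast
  qed
  have mono_iff: "refines {1..k} (Union ` \<Sigma>) \<rho> \<longleftrightarrow> (\<forall>C\<in>\<Sigma>. \<forall>P\<in>C. \<forall>Q\<in>C. colour P = colour Q)"
    if S: "partition_on \<pi> \<Sigma>" for \<Sigma>
  proof -
    have part: "partition_on {1..k} (Union ` \<Sigma>)"
      using bij_betwE[OF coarsenings_bij[OF p]] S by (auto simp: refines_def)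
    have "(\<exists>B\<in>\<rho>. \<Union>C \<subseteq> B) \<longleftrightarrow> (\<forall>P\<in>C. \<forall>Q\<in>C. colour P = colour Q)" if C: "C \<in> \<Sigma>" for C
    proof
      have sub: "C \<subseteq> \<pi>" using C S by (auto simp: partition_on_def)
      show "\<forall>P\<in>C. \<forall>Q\<in>C. colour P = colour Q" if "\<exists>B\<in>\<rho>. \<Union>C \<subseteq> B"
      proof -
        from that obtain B where B: "B \<in> \<rho>" "\<Union>C \<subseteq> B" by blast
        then have "colour P = {B}" if "P \<in> C" for P
          using colour_eq[of P B] sub that by blast
        then show ?thesis by simp
      qed
      show "\<exists>B\<in>\<rho>. \<Union>C \<subseteq> B" if same: "\<forall>P\<in>C. \<forall>Q\<in>C. colour P = colour Q"
      proof -
        obtain P where P: "P \<in> C" using partition_onD3[OF S] C by (metis ex_in_conv)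
        then obtain B where B: "B \<in> \<rho>" "P \<subseteq> B" using True sub P unfolding refines_def by blast
        have "Q \<subseteq> B" if "Q \<in> C" for Q
        proof -
          have "B \<in> colour P" using B by (simp add: colour_def)
          also have "colour P = colour Q" using same P that by blast
          finally show ?thesis by (simp add: colour_def)
        qed
        then have "\<Union>C \<subseteq> B" by blast
        then show ?thesis using B(1) by blast
      qed
    qed
    then show ?thesis using part r by (simp add: refines_def)
  qed
  have inj_iff: "inj_on colour \<pi> \<longleftrightarrow> \<pi> = \<rho>"
  proof
    assume "\<pi> = \<rho>"
    then have "colour P = {P}" if "P \<in> \<pi>" for P using colour_eq[OF that, of P] that by simp
    then show "inj_on colour \<pi>" by (auto simp: inj_on_def)
  next
    assume inj: "inj_on colour \<pi>"
    have "refines {1..k} \<rho> \<pi>"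
      unfolding refines_def
    proof (intro conjI ballI p r)
      fix B assume B: "B \<in> \<rho>"
      have un: "B = \<Union>{P \<in> \<pi>. P \<subseteq> B}"
        by (rule partition_onD1[OF refines_obtains_subset[OF True B]])
      have "B \<noteq> {}" using B partition_onD3[OF r] by auto
      then obtain P where P: "P \<in> \<pi>" "P \<subseteq> B" using un by blast
      have "Q = P" if "Q \<in> \<pi>" "Q \<subseteq> B" for Q
        using inj_onD[OF inj _ that(1) P(1)] colour_eq[OF that(1) B that(2)] colour_eq[OF P(1) B P(2)]
        by simp
      then have "B \<subseteq> P" using un by blast
      then show "\<exists>P\<in>\<pi>. B \<subseteq> P" using P by blast
    qed
    then show "\<pi> = \<rho>" using True refines_asym by blast
  qed
  have fin: "finite (set_partitions k)"
    unfolding set_partitions_def by (rule finitely_many_partition_on) simp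
  have fin_\<pi>: "finite \<pi>" by (rule finite_elements[OF finite_atLeastAtMost p])
  have "(\<Sum>\<sigma>\<in>set_partitions k. moebius k \<pi> \<sigma> * zeta k \<sigma> \<rho>) =
      (\<Sum>\<sigma> | refines {1..k} \<pi> \<sigma>. moebius k \<pi> \<sigma> * zeta k \<sigma> \<rho>)"
    by (rule sum.mono_neutral_right[OF fin])
      (auto simp: set_partitions_def refines_def moebius_def)
  also have "\<dots> = (\<Sum>\<Sigma> | partition_on \<pi> \<Sigma>. moebius k \<pi> (Union ` \<Sigma>) * zeta k (Union ` \<Sigma>) \<rho>)"
    by (rule sum.reindex_bij_betw[OF coarsenings_bij[OF p], symmetric])
  also have "\<dots> = (\<Sum>\<Sigma> | partition_on \<pi> \<Sigma>.
      if \<forall>C\<in>\<Sigma>. \<forall>P\<in>C. \<forall>Q\<in>C. colour P = colour Q then \<Prod>C\<in>\<Sigma>. block_weight (card C) else 0)"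
  proof (intro sum.cong refl)
    fix \<Sigma> assume "\<Sigma> \<in> {\<Sigma>. partition_on \<pi> \<Sigma>}"
    then have S: "partition_on \<pi> \<Sigma>" by simp
    have "x * (if b then 1 else 0) = (if b then x else 0)" for x :: real and b by simp
    then show "moebius k \<pi> (Union ` \<Sigma>) * zeta k (Union ` \<Sigma>) \<rho> =
        (if \<forall>C\<in>\<Sigma>. \<forall>P\<in>C. \<forall>Q\<in>C. colour P = colour Q then \<Prod>C\<in>\<Sigma>. block_weight (card C) else 0)"
      unfolding moebius_coarsening[OF p S] zeta_def mono_iff[OF S] .
  qed
  also have "\<dots> = (\<Sum>\<Sigma> | partition_on \<pi> \<Sigma> \<and> (\<forall>C\<in>\<Sigma>. \<forall>P\<in>C. \<forall>Q\<in>C. colour P = colour Q).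
      \<Prod>C\<in>\<Sigma>. block_weight (card C))"
    using sum.inter_filter[OF finitely_many_partition_on[OF fin_\<pi>], symmetric]
    unfolding mem_Collect_eq .
  also have "\<dots> = (if \<pi> = \<rho> then 1 else 0)"
    unfolding inj_iff[symmetric] by (rule sum_weights_monochromatic_partitions[OF fin_\<pi>])
  finally show ?thesis .
qed

section \<open>Integrals of monomials in the entries of a permutation matrix\<close>

text \<open>
  One permutation \<open>g0\<close> extending \<open>h\<close> exists because the complements of \<open>A\<close> and \<open>h ` A\<close> have equal
  size; the others are \<open>g0 \<circ> q\<close> with \<open>q\<close> fixing \<open>A\<close> pointwise.
\<close>

lemma card_permutations_extending:
  assumes S: "finite S" and A: "A \<subseteq> S" and h: "inj_on h A" "h ` A \<subseteq> S"
  shows "card {g. g permutes S \<and> (\<forall>a\<in>A. g a = h a)} = fact (card S - card A)"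
proof -
  have finA: "finite A" using A S by (rule finite_subset)
  have "card (S - A) = card (S - h ` A)"
    using A h S finA by (simp add: card_Diff_subset card_image)
  then obtain e where e: "bij_betw e (S - A) (S - h ` A)"
    using S by (metis finite_Diff finite_same_card_bij)
  define g0 where "g0 = (\<lambda>x. if x \<in> A then h x else if x \<in> S then e x else x)"
  have "bij_betw g0 A (h ` A)"
    using h(1) by (simp add: g0_def bij_betw_def inj_on_def)
  moreover have "bij_betw g0 (S - A) (S - h ` A)"
    using e by (subst bij_betw_cong[where g = e]) (auto simp: g0_def)
  ultimately have "bij_betw g0 (A \<union> (S - A)) (h ` A \<union> (S - h ` A))"
    by (rule bij_betw_combine) auto
  then have "bij_betw g0 S S" using A h(2) by (simp add: Un_absorb1)
  then have g0: "g0 permutes S"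
    by (rule bij_imp_permutes) (use A in \<open>auto simp: g0_def\<close>)
  have g0_eq: "g0 a = h a" if "a \<in> A" for a using that by (simp add: g0_def)
  have "bij_betw ((\<circ>) g0) {q. q permutes (S - A)} {g. g permutes S \<and> (\<forall>a\<in>A. g a = h a)}"
  proof (rule bij_betwI[where g = "(\<circ>) (inv g0)"])
    show "(\<circ>) g0 \<in> {q. q permutes (S - A)} \<rightarrow> {g. g permutes S \<and> (\<forall>a\<in>A. g a = h a)}"
    proof safe
      fix q assume q: "q permutes (S - A)"
      then show "g0 \<circ> q permutes S"
        by (intro permutes_compose g0 permutes_subset[OF q]) auto
      show "(g0 \<circ> q) a = h a" if "a \<in> A" for a
        using permutes_not_in[OF q, of a] that g0_eq by simp
    qed
    show "(\<circ>) (inv g0) \<in> {g. g permutes S \<and> (\<forall>a\<in>A. g a = h a)} \<rightarrow> {q. q permutes (S - A)}"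
    proof safe
      fix g assume g: "g permutes S" "\<forall>a\<in>A. g a = h a"
      show "inv g0 \<circ> g permutes S - A"
      proof (rule permutes_superset[where S = S])
        show "inv g0 \<circ> g permutes S"
          by (intro permutes_compose permutes_inv g0 g)
        fix x assume "x \<in> S - (S - A)"
        then have "g x = g0 x" using g g0_eq by auto
        then show "(inv g0 \<circ> g) x = x"
          by (simp add: permutes_inverses(2)[OF g0])
      qed
    qed
  qed (auto simp: o_assoc permutes_inv_o[OF g0])
  then have "card {g. g permutes S \<and> (\<forall>a\<in>A. g a = h a)} = card {q. q permutes (S - A)}"
    by (simp add: bij_betw_same_card)
  also have "\<dots> = fact (card S - card A)"
    using S finA A by (intro card_permutations) (auto simp: card_Diff_subset)
  finally show ?thesis .
qed

lemma falling_factorial_eq_fact_ratio: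
  "n \<le> N \<Longrightarrow> falling_factorial (real N) n * fact (N - n) = fact N"
proof (induction n)
  case (Suc n)
  have "falling_factorial (real N) (Suc n) * fact (N - Suc n) =
      falling_factorial (real N) n * (real (N - n) * fact (N - Suc n))"
    using Suc.prems by (simp add: falling_factorial_def of_nat_diff)
  also have "real (N - n) * fact (N - Suc n) = fact (N - n)"
    using Suc.prems by (metis Suc_diff_Suc Suc_le_lessD fact_Suc)
  finally show ?case using Suc by simp
qed (simp add: falling_factorial_def)

text \<open>
  Labelling the blocks by the values that \<open>i\<close> takes shows that there are as many blocks as distinct
  indices, which is how the number of blocks enters the integral.
\<close>

lemma index_partition_fibres:
  "index_partition k i = (\<lambda>a. {m \<in> {1..k}. i m = a}) ` i ` {1..k}"
  unfolding image_image index_partition_def quotient_def UNION_singleton_eq_range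
  by (intro image_cong refl) auto

lemma index_partition_in_set_partitions: "index_partition k i \<in> set_partitions k"
  unfolding set_partitions_def index_partition_def mem_Collect_eq
  by (rule partition_on_quotient, rule equivI)
    (auto simp: refl_on_def sym_def trans_def)

lemma card_index_partition: "card (index_partition k i) = card (i ` {1..k})"
  unfolding index_partition_fibres by (intro card_image inj_onI) blast

lemma index_partition_eq_iff:
  "index_partition k i = index_partition k j \<longleftrightarrow>
     (\<forall>l\<in>{1..k}. \<forall>m\<in>{1..k}. i l = i m \<longleftrightarrow> j l = j m)"
proof
  have same_block: "(\<exists>B\<in>index_partition k f. l \<in> B \<and> m \<in> B) \<longleftrightarrow> f l = f m"
    if "l \<in> {1..k}" "m \<in> {1..k}" for f l m
    unfolding index_partition_fibres using that by auto
  show "\<forall>l\<in>{1..k}. \<forall>m\<in>{1..k}. i l = i m \<longleftrightarrow> j l = j m"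
    if "index_partition k i = index_partition k j"
    using same_block[of _ _ i] same_block[of _ _ j] unfolding that by blast
  assume "\<forall>l\<in>{1..k}. \<forall>m\<in>{1..k}. i l = i m \<longleftrightarrow> j l = j m"
  then have "{(l, m). l \<in> {1..k} \<and> m \<in> {1..k} \<and> i l = i m} =
      {(l, m). l \<in> {1..k} \<and> m \<in> {1..k} \<and> j l = j m}"
    by blast
  then show "index_partition k i = index_partition k j"
    unfolding index_partition_def by simp
qed

text \<open>
  The integrand is the indicator of the permutations with \<open>g(i\<^sub>l) = j\<^sub>l\<close> for all \<open>l\<close>. If the index
  partitions agree, these are the extensions of a well-defined injection from the values of \<open>i\<close> to
  the values of \<open>j\<close>; otherwise there are none.
\<close>

theorem sym_integral_monomial:
  assumes i: "i \<in> {1..k} \<rightarrow> {1..N}" and j: "j \<in> {1..k} \<rightarrow> {1..N}"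
  shows "sym_integral N (\<lambda>g. \<Prod>l = 1..k. perm_matrix g (i l) (j l)) =
    (if index_partition k i = index_partition k j
     then 1 / falling_factorial (real N) (card (index_partition k i)) else 0)"
proof -
  let ?G = "{g. g permutes {1..N} \<and> (\<forall>l\<in>{1..k}. g (i l) = j l)}"
  have "(\<Prod>l = 1..k. perm_matrix g (i l) (j l)) = (if \<forall>l\<in>{1..k}. g (i l) = j l then 1 else 0)" for g
    by (auto simp: perm_matrix_def intro!: prod_zero)
  then have int: "sym_integral N (\<lambda>g. \<Prod>l = 1..k. perm_matrix g (i l) (j l)) = real (card ?G) / fact N"
    by (simp add: sym_integral_def sum.If_cases finite_permutations Int_def)
  show ?thesis
  proof (cases "index_partition k i = index_partition k j")
    case True
    let ?b = "card (index_partition k i)"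
    define h where "h = (\<lambda>a. j (SOME l. l \<in> {1..k} \<and> i l = a))"
    have h: "h (i l) = j l" if "l \<in> {1..k}" for l
    proof -
      have "(SOME m. m \<in> {1..k} \<and> i m = i l) \<in> {1..k} \<and> i (SOME m. m \<in> {1..k} \<and> i m = i l) = i l"
        by (rule someI[of _ l]) (use that in simp)
      then show ?thesis
        using True that unfolding index_partition_eq_iff h_def by blast
    qed
    have "inj_on h (i ` {1..k})"
      using True unfolding index_partition_eq_iff by (auto simp: inj_on_def h)
    moreover have "h ` i ` {1..k} \<subseteq> {1..N}" using j h by force
    moreover have sub: "i ` {1..k} \<subseteq> {1..N}" using i by auto
    ultimately have "card {g. g permutes {1..N} \<and> (\<forall>a\<in>i ` {1..k}. g a = h a)} =
        fact (card {1..N} - card (i ` {1..k}))"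
      by (intro card_permutations_extending) auto
    moreover have "{g. g permutes {1..N} \<and> (\<forall>a\<in>i ` {1..k}. g a = h a)} = ?G"
      using h by auto
    ultimately have "card ?G = fact (N - card (index_partition k i))"
      by (simp add: card_index_partition)
    moreover have "card (index_partition k i) \<le> N"
      using card_mono[OF _ sub] by (simp add: card_index_partition)
    ultimately have G: "real (card ?G) = fact (N - ?b)" and b: "?b \<le> N"
      by simp_all
    have ratio: "falling_factorial (real N) ?b * fact (N - ?b) = fact N"
      by (rule falling_factorial_eq_fact_ratio[OF b])
    then have "falling_factorial (real N) ?b \<noteq> 0"
      by (metis fact_nonzero mult_zero_left)
    then have "fact (N - ?b) / fact N = 1 / falling_factorial (real N) ?b"
      unfolding ratio[symmetric] by simp
    then show ?thesis
      using True by (simp only: int G refl if_True)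
  next
    case False
    have "?G = {}"
    proof (rule ccontr)
      assume "?G \<noteq> {}"
      then obtain g where g: "g permutes {1..N}" "\<And>l. l \<in> {1..k} \<Longrightarrow> g (i l) = j l" by blast
      have "i l = i m \<longleftrightarrow> j l = j m" if "l \<in> {1..k}" "m \<in> {1..k}" for l m
        using inj_eq[OF permutes_inj[OF g(1)], of "i l" "i m"] g(2)[OF that(1)] g(2)[OF that(2)]
        by simp
      then show False using False unfolding index_partition_eq_iff by blast
    qed
    then have "card ?G = 0" by (simp only: card.empty)
    then show ?thesis using False by (simp only: int if_False of_nat_0 div_0)
  qed
qed

section \<open>The Weingarten formula\<close>

theorem theorem2p1:
  fixes k :: nat
  assumes "k \<ge> 1"
  shows "\<exists>Wg :: nat set set \<Rightarrow> nat set set \<Rightarrow> nat \<Rightarrow> real.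
    (\<forall>N. \<forall>i \<in> {1..k} \<rightarrow> {1..N}. \<forall>j \<in> {1..k} \<rightarrow> {1..N}.
       sym_integral N (\<lambda>g. \<Prod>l = 1..k. perm_matrix g (i l) (j l)) =
         (\<Sum>\<sigma> \<in> set_partitions k. \<Sum>\<tau> \<in> set_partitions k.
            Wg \<sigma> \<tau> N * zeta k \<sigma> (index_partition k i) * zeta k \<tau> (index_partition k j))) \<and>
    (\<forall>N. \<forall>\<sigma> \<in> set_partitions k. \<forall>\<tau> \<in> set_partitions k.
       Wg \<sigma> \<tau> N =
         (\<Sum>\<pi> | \<pi> \<in> set_partitions k \<and> refines {1..k} \<pi> (common_refinement {\<sigma>, \<tau>}).
            moebius k \<pi> \<sigma> * moebius k \<pi> \<tau> * (1 / falling_factorial (real N) (card \<pi>))))"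
proof -
  let ?SP = "set_partitions k"
  define c where "c = (\<lambda>N \<pi>. 1 / falling_factorial (real N) (card (\<pi> :: nat set set)))"
  define Wg where "Wg = (\<lambda>\<sigma> \<tau> N.
    \<Sum>\<pi> | \<pi> \<in> ?SP \<and> refines {1..k} \<pi> (common_refinement {\<sigma>, \<tau>}).
      moebius k \<pi> \<sigma> * moebius k \<pi> \<tau> * c N \<pi>)"
  have fin: "finite ?SP"
    unfolding set_partitions_def by (rule finitely_many_partition_on) simp
  \<comment> \<open>The function \<open>\<mu>\<close> vanishes off the refinement order, so the sum may run over all \<open>\<pi>\<close>.\<close>
  have Wg: "Wg \<sigma> \<tau> N = (\<Sum>\<pi>\<in>?SP. moebius k \<pi> \<sigma> * moebius k \<pi> \<tau> * c N \<pi>)"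
    if "\<sigma> \<in> ?SP" "\<tau> \<in> ?SP" for \<sigma> \<tau> N
    unfolding Wg_def common_refinement_is_meet(2)[OF that]
    by (rule sum.mono_neutral_left[OF fin]) (auto simp: moebius_def)
  have "sym_integral N (\<lambda>g. \<Prod>l = 1..k. perm_matrix g (i l) (j l)) =
      (\<Sum>\<sigma>\<in>?SP. \<Sum>\<tau>\<in>?SP. Wg \<sigma> \<tau> N * zeta k \<sigma> (index_partition k i) * zeta k \<tau> (index_partition k j))"
    if "i \<in> {1..k} \<rightarrow> {1..N}" "j \<in> {1..k} \<rightarrow> {1..N}" for N i j
  proof -
    let ?I = "index_partition k i" and ?J = "index_partition k j"
    have "(\<Sum>\<sigma>\<in>?SP. \<Sum>\<tau>\<in>?SP. Wg \<sigma> \<tau> N * zeta k \<sigma> ?I * zeta k \<tau> ?J) =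
        (\<Sum>\<sigma>\<in>?SP. \<Sum>\<tau>\<in>?SP. \<Sum>\<pi>\<in>?SP.
           c N \<pi> * ((moebius k \<pi> \<sigma> * zeta k \<sigma> ?I) * (moebius k \<pi> \<tau> * zeta k \<tau> ?J)))"
      by (intro sum.cong refl) (simp add: Wg sum_distrib_left sum_distrib_right mult_ac)
    also have "\<dots> = (\<Sum>\<sigma>\<in>?SP. \<Sum>\<pi>\<in>?SP. \<Sum>\<tau>\<in>?SP.
           c N \<pi> * ((moebius k \<pi> \<sigma> * zeta k \<sigma> ?I) * (moebius k \<pi> \<tau> * zeta k \<tau> ?J)))"
      by (intro sum.cong refl sum.swap)
    also have "\<dots> = (\<Sum>\<pi>\<in>?SP. \<Sum>\<sigma>\<in>?SP. \<Sum>\<tau>\<in>?SP.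
           c N \<pi> * ((moebius k \<pi> \<sigma> * zeta k \<sigma> ?I) * (moebius k \<pi> \<tau> * zeta k \<tau> ?J)))"
      by (rule sum.swap)
    also have "\<dots> = (\<Sum>\<pi>\<in>?SP. c N \<pi> * ((\<Sum>\<sigma>\<in>?SP. moebius k \<pi> \<sigma> * zeta k \<sigma> ?I) *
           (\<Sum>\<tau>\<in>?SP. moebius k \<pi> \<tau> * zeta k \<tau> ?J)))"
      by (simp only: sum_product) (simp only: sum_distrib_left)
    also have "\<dots> = (\<Sum>\<pi>\<in>?SP. if \<pi> = ?I then (if ?I = ?J then c N ?I else 0) else 0)"
      by (intro sum.cong refl) (auto simp: moebius_inverts_zeta index_partition_in_set_partitions)
    also have "\<dots> = (if ?I = ?J then c N ?I else 0)"
      using fin by (simp add: sum.delta index_partition_in_set_partitions)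
    finally show ?thesis
      using sym_integral_monomial[OF that] by (simp add: c_def)
  qed
  then show ?thesis
    by (intro exI[of _ Wg]) (auto simp: Wg_def c_def)
qed

end
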